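(* The class of hyperexponential distributions $\mathcal{C}_{hexp}$ is a subclass of $\mathcal{C}_0$; that is, every hyperexponential distribution belongs to $\mathcal{C}_0$.
   Context: A cdf $F$ on $\mathbb{R}^+$ is hyperexponential if there are an integer $n\ge1$, probabilities $\tilde p_1,\dots,\tilde p_n$ with $\sum_{k=1}^n\tilde p_k=1$ and reals $\mu_1,\dots,\mu_n>0$ such that $F(t)=1-\sum_{k=1}^n\tilde p_k e^{-\mu_k t}$. $\mathcal{C}_{hexp}$ is the set of all hyperexponential distributions. A cdf $F$ has a Coxian representation with parameters $n\ge1$, $\mu_1,\dots,\mu_n>0$, $p_1,\dots,p_{n-1}\in(0,1)$ (and $p_n=0$ by convention) if $F(t)=1-(1,0,\dots,0)e^{St}\underline{1}$ for $t\ge 0$, where $\underline{1}$ is the column vector of ones and $S$ is the $n\times n$ upper bidiagonal matrix with $S_{i,i}=-\mu_i$ for $1\le i\le n$ and $S_{i,i+1}=p_i\mu_i$ for $1\le i\le n-1$ (all other entries zero). $\mathcal{C}_0$ is the class of distributions on $\mathbb{R}^+$ having some Coxian representation (of some order $n\ge 1$) for which $\mu_i(1-p_i)$ is (strictly) decreasing in $i\in\{1,\dots,n\}$. *)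

theory Defs
  imports "HOL-Probability.Distribution_Functions" "Jordan_Normal_Form.Matrix"
begin

definition nonneg_distributions :: "real measure set" where
  "nonneg_distributions = {M. real_distribution M \<and> (AE x in M. 0 \<le> x)}"

definition hyperexponential_cdf :: "(real \<Rightarrow> real) \<Rightarrow> bool" where
  "hyperexponential_cdf F \<longleftrightarrow>
     (\<exists>(n::nat) (q :: nat \<Rightarrow> real) (\<mu> :: nat \<Rightarrow> real).
        n \<ge> 1 \<and> (\<forall>k\<in>{1..n}. 0 \<le> q k \<and> q k \<le> 1) \<and> (\<Sum>k=1..n. q k) = 1 \<and>
        (\<forall>k\<in>{1..n}. 0 < \<mu> k) \<and>
        (\<forall>t\<ge>0. F t = 1 - (\<Sum>k=1..n. q k * exp (- \<mu> k * t))))"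

definition C_hexp :: "real measure set" where
  "C_hexp = {M \<in> nonneg_distributions. hyperexponential_cdf (cdf M)}"

text \<open>For a square matrix the exponential series converges absolutely in every entry.\<close>

definition mat_exp :: "real mat \<Rightarrow> real mat" where
  "mat_exp A = mat (dim_row A) (dim_row A) (\<lambda>(i, j). \<Sum>k. (A ^\<^sub>m k) $$ (i, j) / fact k)"

text \<open>Matrix entries are indexed from 0, the parameters \<open>\<mu>\<close> and \<open>p\<close> from 1.\<close>

definition coxian_matrix :: "nat \<Rightarrow> (nat \<Rightarrow> real) \<Rightarrow> (nat \<Rightarrow> real) \<Rightarrow> real mat" where
  "coxian_matrix n \<mu> p = mat n n (\<lambda>(i, j).
     if j = i then - \<mu> (i + 1)
     else if j = i + 1 then p (i + 1) * \<mu> (i + 1)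
     else 0)"

definition coxian_representation ::
    "(real \<Rightarrow> real) \<Rightarrow> nat \<Rightarrow> (nat \<Rightarrow> real) \<Rightarrow> (nat \<Rightarrow> real) \<Rightarrow> bool" where
  "coxian_representation F n \<mu> p \<longleftrightarrow>
     n \<ge> 1 \<and> (\<forall>i\<in>{1..n}. 0 < \<mu> i) \<and> (\<forall>i\<in>{1..<n}. 0 < p i \<and> p i < 1) \<and> p n = 0 \<and>
     (\<forall>t\<ge>0. F t = 1 - scalar_prod (unit_vec n 0)
        (mat_exp (t \<cdot>\<^sub>m coxian_matrix n \<mu> p) *\<^sub>v Matrix.vec n (\<lambda>_. 1)))"

definition C_0 :: "real measure set" where
  "C_0 = {M \<in> nonneg_distributions. \<exists>n \<mu> p. coxian_representation (cdf M) n \<mu> p \<and>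
            strict_antimono_on {1..n} (\<lambda>i. \<mu> i * (1 - p i))}"

end

theory Submission
  imports Defs
begin

unbundle no vec_syntax

text \<open>
  Merging equal rates and dropping zero weights, a hyperexponential distribution is a mixture with
  weights \<open>q\<^sub>k > 0\<close> and rates \<open>\<mu>\<^sub>1 > \<dots> > \<mu>\<^sub>n\<close>. Put
  \<open>W\<^sub>i(k) = q\<^sub>k \<Prod>\<^sub>j\<^sub><\<^sub>i (\<mu>\<^sub>j - \<mu>\<^sub>k)\<close> and \<open>Z\<^sub>i = \<Sum>\<^sub>k W\<^sub>i(k)\<close>. With the rates in decreasing order and
  \<open>p\<^sub>i = Z\<^sub>i\<^sub>+\<^sub>1 / (\<mu>\<^sub>i Z\<^sub>i)\<close>, the Coxian chain started in phase \<open>i\<close> has survival function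
  \<open>\<Sum>\<^sub>k W\<^sub>i(k) exp (-\<mu>\<^sub>k t) / Z\<^sub>i\<close>. The exit rate \<open>\<mu>\<^sub>i (1 - p\<^sub>i)\<close> is the mean of \<open>\<mu>\<close> under the
  probability weights \<open>W\<^sub>i / Z\<^sub>i\<close>, and its strict decrease in \<open>i\<close> is equivalent to the positivity of
  the variance of \<open>\<mu>\<close> under these weights.
\<close>

section \<open>Matrix exponentials\<close>

text \<open>Each further factor \<open>A\<close> turns an entry into a sum of \<open>n\<close>
  products, so the bound grows by \<open>real n * b\<close>. This lets a scalar exponential series
  dominate the matrix series entrywise.\<close>

lemma pow_mat_entry_bound:
  fixes A :: "real mat"
  assumes A: "A \<in> carrier_mat n n"
    and bound: "\<And>i j. i < n \<Longrightarrow> j < n \<Longrightarrow> \<bar>A $$ (i, j)\<bar> \<le> b"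
    and "i < n" "j < n"
  shows "\<bar>(A ^\<^sub>m k) $$ (i, j)\<bar> \<le> (real n * b) ^ k"
  using \<open>j < n\<close>
proof (induction k arbitrary: j)
  case 0
  then show ?case using A \<open>i < n\<close> by auto
next
  case (Suc k)
  have b: "0 \<le> b" using bound[OF \<open>i < n\<close> \<open>i < n\<close>] by linarith
  have Ak: "A ^\<^sub>m k \<in> carrier_mat n n" using A by simp
  have "(A ^\<^sub>m Suc k) $$ (i, j) = (\<Sum>l<n. (A ^\<^sub>m k) $$ (i, l) * A $$ (l, j))"
    using A Ak \<open>i < n\<close> Suc.prems
    by (simp add: scalar_prod_def atLeast0LessThan)
  also have "\<bar>\<dots>\<bar> \<le> (\<Sum>l<n. \<bar>(A ^\<^sub>m k) $$ (i, l)\<bar> * \<bar>A $$ (l, j)\<bar>)"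
    by (rule order_trans[OF sum_abs]) (simp add: abs_mult)
  also have "\<dots> \<le> (\<Sum>l<n. (real n * b) ^ k * b)"
    by (intro sum_mono mult_mono) (use Suc bound b in auto)
  also have "\<dots> = (real n * b) ^ Suc k" by simp
  finally show ?case .
qed

lemma summable_mat_exp_entry:
  fixes A :: "real mat"
  assumes A: "A \<in> carrier_mat n n" and "i < n" "j < n"
  shows "summable (\<lambda>k. (A ^\<^sub>m k) $$ (i, j) / fact k)"
proof -
  define b where "b = (\<Sum>(i, j)\<in>{..<n} \<times> {..<n}. \<bar>A $$ (i, j)\<bar>)"
  have "\<bar>A $$ (i', j')\<bar> \<le> b" if "i' < n" "j' < n" for i' j'
  proof -
    have "(case (i', j') of (i, j) \<Rightarrow> \<bar>A $$ (i, j)\<bar>) \<le> b"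
      unfolding b_def by (rule member_le_sum) (use that in auto)
    then show ?thesis by simp
  qed
  then have "\<bar>(A ^\<^sub>m k) $$ (i, j)\<bar> \<le> (real n * b) ^ k" for k
    using pow_mat_entry_bound[OF A] assms by blast
  then have "norm ((A ^\<^sub>m k) $$ (i, j) / fact k) \<le> inverse (fact k) * (real n * b) ^ k" for k
    by (simp add: field_simps)
  then show ?thesis
    by (intro summable_comparison_test'[OF summable_exp, where N = 0])
qed

text \<open>Once the whole orbit of \<open>v 0\<close> under \<open>A\<close> is known in closed
  form, the exponential acts on \<open>v 0\<close> termwise, and no powers of \<open>A\<close> have
  to be computed.\<close>

lemma mat_exp_mult_vec_index:
  fixes A :: "real mat"
  assumes A: "A \<in> carrier_mat n n"
    and v: "\<And>m. v m \<in> carrier_vec n"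
    and Av: "\<And>m. A *\<^sub>v v m = v (Suc m)"
    and "i < n"
  shows "(mat_exp A *\<^sub>v v 0) $ i = (\<Sum>m. v m $ i / fact m)"
proof -
  have pow: "A ^\<^sub>m m *\<^sub>v v l = v (m + l)" for m l
  proof (induction m arbitrary: l)
    case 0
    then show ?case using A v by simp
  next
    case (Suc m)
    \<comment> \<open>Powers of matrices grow on the right, so the new factor meets
      \<open>v l\<close> first and shifts \<open>l\<close>; hence the induction is over arbitrary
      \<open>l\<close>.\<close>
    have "A ^\<^sub>m Suc m *\<^sub>v v l = A ^\<^sub>m m *\<^sub>v (A *\<^sub>v v l)"
      using A v[of l] by (simp add: assoc_mult_mat_vec[of _ n n _ n])
    then show ?case using Suc Av by simp
  qed
  have entry: "v m $ i = (\<Sum>j<n. (A ^\<^sub>m m) $$ (i, j) * v 0 $ j)" for m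
  proof -
    have "v m $ i = (A ^\<^sub>m m *\<^sub>v v 0) $ i" using pow[of m 0] by simp
    also have "\<dots> = (\<Sum>j<n. (A ^\<^sub>m m) $$ (i, j) * v 0 $ j)"
      using A v[of 0] pow_carrier_mat[OF A, of m] \<open>i < n\<close>
      by (simp add: scalar_prod_def atLeast0LessThan)
    finally show ?thesis .
  qed
  have summ: "summable (\<lambda>m. (A ^\<^sub>m m) $$ (i, j) / fact m)" if "j < n" for j
    using summable_mat_exp_entry[OF A \<open>i < n\<close> that] .
  have "(mat_exp A *\<^sub>v v 0) $ i = (\<Sum>j<n. (\<Sum>m. (A ^\<^sub>m m) $$ (i, j) / fact m) * v 0 $ j)"
    using A v[of 0] \<open>i < n\<close> by (simp add: mat_exp_def scalar_prod_def atLeast0LessThan)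
  also have "\<dots> = (\<Sum>j<n. \<Sum>m. (A ^\<^sub>m m) $$ (i, j) / fact m * v 0 $ j)"
    using summ by (intro sum.cong) (auto simp: suminf_mult2)
  also have "\<dots> = (\<Sum>m. \<Sum>j<n. (A ^\<^sub>m m) $$ (i, j) / fact m * v 0 $ j)"
    using summ by (intro suminf_sum[symmetric] summable_mult2) auto
  also have "\<dots> = (\<Sum>m. v m $ i / fact m)"
    by (simp add: entry sum_divide_distrib)
  finally show ?thesis .
qed

section \<open>The Coxian representation of a mixture with decreasing rates\<close>

locale exponential_mixture =
  fixes n :: nat and q \<mu> :: "nat \<Rightarrow> real"
  assumes n_pos: "1 \<le> n"
    and q_pos: "\<And>k. k \<in> {1..n} \<Longrightarrow> 0 < q k"
    and q_sum: "(\<Sum>k=1..n. q k) = 1"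
    and mu_pos: "\<And>k. k \<in> {1..n} \<Longrightarrow> 0 < \<mu> k"
    and mu_dec: "strict_antimono_on {1..n} \<mu>"
begin

definition weight :: "nat \<Rightarrow> nat \<Rightarrow> real" where
  "weight i k = q k * (\<Prod>j\<in>{1..<i}. \<mu> j - \<mu> k)"

definition mass :: "nat \<Rightarrow> real" where
  "mass i = (\<Sum>k=1..n. weight i k)"

definition moment :: "nat \<Rightarrow> real" where
  "moment i = (\<Sum>k=1..n. weight i k * \<mu> k)"

definition continuation :: "nat \<Rightarrow> real" where
  "continuation i = mass (Suc i) / (\<mu> i * mass i)"

lemma mu_less: "\<mu> k < \<mu> j" if "1 \<le> j" "j < k" "k \<le> n" for j k
  using mu_dec that by (auto simp: monotone_on_def)

lemma weight_1: "weight (Suc 0) k = q k"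
  by (simp add: weight_def)

lemma weight_Suc: "weight (Suc i) k = weight i k * (\<mu> i - \<mu> k)" if "1 \<le> i"
  using that by (simp add: weight_def atLeastLessThanSuc)

text \<open>The product contains the vanishing factor with \<open>j = k\<close>. For
  \<open>k\<close> from \<open>i\<close> to \<open>n\<close> all factors are positive because the
  rates decrease.\<close>

lemma weight_eq_0: "weight i k = 0" if "1 \<le> k" "k < i"
  using that by (auto simp: weight_def)

lemma weight_pos: "0 < weight i k" if "1 \<le> i" "i \<le> k" "k \<le> n"
  unfolding weight_def
  by (intro mult_pos_pos prod_pos) (use that q_pos mu_less in auto)

lemma weight_nonneg: "0 \<le> weight i k" if "1 \<le> i" "k \<in> {1..n}"
  using weight_pos[of i k] weight_eq_0[of k i] that by (cases "k < i") auto

lemma mass_1: "mass (Suc 0) = 1"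
  using q_sum by (simp add: mass_def weight_1)

lemma mass_pos: "0 < mass i" if "i \<in> {1..n}"
  unfolding mass_def
  \<comment> \<open>The last rate has positive weight for every \<open>i\<close> up to
    \<open>n\<close>.\<close>
  by (rule sum_pos2[of _ n]) (use that weight_pos weight_nonneg in auto)

lemma moment_pos: "0 < moment i" if "i \<in> {1..n}"
  unfolding moment_def
  by (rule sum_pos2[of _ n])
     (use that weight_pos[of i n] weight_nonneg[of i] mu_pos less_imp_le[OF mu_pos] in auto)

lemma mass_Suc: "mass (Suc i) = \<mu> i * mass i - moment i" if "1 \<le> i"
  by (simp add: mass_def moment_def weight_Suc[OF that] algebra_simps sum_subtractf sum_distrib_left)

text \<open>By \<open>mass_Suc\<close>, the upper bound amounts to positivity of
  \<open>moment i\<close>.\<close>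

lemma continuation_bounds:
  assumes "i \<in> {1..<n}"
  shows "0 < continuation i" "continuation i < 1"
proof -
  have i: "i \<in> {1..n}" "Suc i \<in> {1..n}" using assms by auto
  show "0 < continuation i"
    using mass_pos[OF i(1)] mass_pos[OF i(2)] mu_pos[OF i(1)] by (simp add: continuation_def)
  show "continuation i < 1"
    using mass_pos[OF i(1)] mu_pos[OF i(1)] moment_pos[OF i(1)] mass_Suc i
    by (simp add: continuation_def)
qed

lemma weight_Suc_n: "weight (Suc n) k = 0" if "k \<in> {1..n}"
  using that by (auto intro: weight_eq_0)

lemma continuation_n: "continuation n = 0"
  by (simp add: continuation_def mass_def weight_Suc_n)

lemma exit_rate: "\<mu> i * (1 - continuation i) = moment i / mass i" if "i \<in> {1..n}"
  using mass_pos[OF that] mu_pos[OF that] mass_Suc[of i] that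
  by (simp add: continuation_def right_diff_distrib diff_divide_distrib)

lemma exit_rate_less:
  assumes "i \<in> {1..<n}"
  shows "moment (Suc i) / mass (Suc i) < moment i / mass i"
proof -
  define V where "V = (\<Sum>k=1..n. weight i k * (\<mu> k)\<^sup>2)"
  define m where "m = moment i / mass i"
  have i: "i \<in> {1..n}" "Suc i \<in> {1..n}" "1 \<le> i" "i < n" using assms by auto
  note Z = mass_pos[OF i(1)] and Z' = mass_pos[OF i(2)]
  \<comment> \<open>Both \<mu> i and \<mu> n carry positive weight and they differ, so at least one
    of them is not the mean \<open>m\<close>. This makes the variance strictly positive.\<close>
  have "\<exists>k\<in>{1..n}. i \<le> k \<and> \<mu> k \<noteq> m"
    using mu_less[of i n] i by (cases "\<mu> i = m") (auto intro: bexI[of _ n] bexI[of _ i])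
  then obtain k where k: "k \<in> {1..n}" "i \<le> k" "\<mu> k \<noteq> m" by blast
  have "0 < (\<Sum>k=1..n. weight i k * (\<mu> k - m)\<^sup>2)"
    by (rule sum_pos2[of _ k]) (use k i weight_pos weight_nonneg in auto)
  also have "\<dots> = V - 2 * m * moment i + m\<^sup>2 * mass i"
    by (simp add: V_def moment_def mass_def power2_diff algebra_simps sum.distrib
        sum_subtractf sum_distrib_left)
  also have "\<dots> = V - (moment i)\<^sup>2 / mass i"
    using Z by (simp add: m_def field_simps power2_eq_square)
  finally have "(moment i)\<^sup>2 < V * mass i"
    using Z by (simp add: field_simps)
  moreover have "moment (Suc i) = \<mu> i * moment i - V"
    by (simp add: moment_def V_def weight_Suc[OF i(3)] algebra_simps sum_subtractf
        sum_distrib_left power2_eq_square)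
  \<comment> \<open>The terms with \<mu> i cancel, leaving exactly the variance expression.\<close>
  moreover have "moment i * mass (Suc i) - moment (Suc i) * mass i =
      V * mass i - (moment i)\<^sup>2"
    unfolding calculation(2) mass_Suc[OF i(3)] by (simp add: algebra_simps power2_eq_square)
  ultimately have "moment (Suc i) * mass i < moment i * mass (Suc i)" by linarith
  then show ?thesis using Z Z' by (simp add: divide_simps)
qed

lemma exit_rate_decreasing: "strict_antimono_on {1..n} (\<lambda>i. \<mu> i * (1 - continuation i))"
proof (rule monotone_onI)
  fix i j assume ij: "i \<in> {1..n}" "j \<in> {1..n}" "i < j"
  have "j \<le> n \<Longrightarrow> moment j / mass j < moment i / mass i"
    using Suc_leI[OF \<open>i < j\<close>]
  proof (induction j rule: dec_induct)
    case base
    then show ?case using exit_rate_less[of i] ij by simp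
  next
    case (step j)
    then show ?case using exit_rate_less[of j] ij by simp
  qed
  then show "\<mu> j * (1 - continuation j) < \<mu> i * (1 - continuation i)"
    using ij by (simp add: exit_rate)
qed

text \<open>The vectors \<open>(W\<^sub>i(k) / Z\<^sub>i)\<^sub>i\<close> are eigenvectors of the Coxian matrix with eigenvalues \<open>-\<mu>\<^sub>k\<close>, and
  their sum over \<open>k\<close> is the all-ones vector.\<close>

lemma coxian_matrix_step:
  "(t \<cdot>\<^sub>m coxian_matrix n \<mu> continuation) *\<^sub>v
      Matrix.vec n (\<lambda>i. (\<Sum>k=1..n. weight (Suc i) k * (- \<mu> k * t) ^ m) / mass (Suc i)) =
    Matrix.vec n (\<lambda>i. (\<Sum>k=1..n. weight (Suc i) k * (- \<mu> k * t) ^ Suc m) / mass (Suc i))"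
  (is "?A *\<^sub>v Matrix.vec n ?f = Matrix.vec n ?g")
proof (rule eq_vecI)
  fix i assume "i < dim_vec (Matrix.vec n ?g)"
  then have i: "i < n" by simp
  note Z = mass_pos[of "Suc i"]
  have mu: "0 < \<mu> (Suc i)" using mu_pos[of "Suc i"] i by simp
  have "(?A *\<^sub>v Matrix.vec n ?f) $ i =
      (\<Sum>j<n. (if j = i then - t * \<mu> (Suc i) * ?f i else 0) +
        (if j = Suc i then t * (continuation (Suc i) * \<mu> (Suc i)) * ?f (Suc i) else 0))"
    using i by (auto simp: coxian_matrix_def scalar_prod_def atLeast0LessThan intro!: sum.cong)
  also have "\<dots> = - t * \<mu> (Suc i) * ?f i +
      (if Suc i < n then t * (continuation (Suc i) * \<mu> (Suc i)) * ?f (Suc i) else 0)"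
    using i by (simp add: sum.distrib)
  \<comment> \<open>The continuation probability cancels the normalisation of the next phase. In the
    last row the formula persists because \<open>weight (Suc n)\<close> vanishes.\<close>
  also have "(if Suc i < n then t * (continuation (Suc i) * \<mu> (Suc i)) * ?f (Suc i) else 0) =
      t * (\<Sum>k=1..n. weight (Suc (Suc i)) k * (- \<mu> k * t) ^ m) / mass (Suc i)"
  proof (cases "Suc i < n")
    case True
    then show ?thesis
      using Z mass_pos[of "Suc (Suc i)"] mu by (simp add: continuation_def)
  next
    case False
    then have "Suc i = n" using i by simp
    then show ?thesis by (simp add: weight_Suc_n)
  qed
  \<comment> \<open>By \<open>weight_Suc\<close> the two coefficients of the \<open>k\<close>-th
    term add up to \<open>- \<mu> k * t\<close>, which supplies the extra power.\<close>
  also have "- t * \<mu> (Suc i) * ?f i +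
      t * (\<Sum>k=1..n. weight (Suc (Suc i)) k * (- \<mu> k * t) ^ m) / mass (Suc i) = ?g i"
    by (simp add: weight_Suc[of "Suc i"] sum_distrib_left add_divide_distrib[symmetric]
        sum.distrib[symmetric] sum_negf[symmetric] algebra_simps)
  finally show "(?A *\<^sub>v Matrix.vec n ?f) $ i = Matrix.vec n ?g $ i"
    using i by simp
qed (simp add: coxian_matrix_def)

lemma survival:
  "scalar_prod (unit_vec n 0)
      (mat_exp (t \<cdot>\<^sub>m coxian_matrix n \<mu> continuation) *\<^sub>v Matrix.vec n (\<lambda>_. 1)) =
    (\<Sum>k=1..n. q k * exp (- \<mu> k * t))"
proof -
  let ?A = "t \<cdot>\<^sub>m coxian_matrix n \<mu> continuation"
  \<comment> \<open>This is the orbit of the all-ones vector: for \<open>m = 0\<close> the numerator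
    is \<open>mass (Suc i)\<close> itself.\<close>
  define v where "v m = Matrix.vec n
    (\<lambda>i. (\<Sum>k=1..n. weight (Suc i) k * (- \<mu> k * t) ^ m) / mass (Suc i))" for m
  have A: "?A \<in> carrier_mat n n" by (simp add: coxian_matrix_def)
  have v0: "v 0 = Matrix.vec n (\<lambda>_. 1)"
  proof (rule eq_vecI)
    fix i assume "i < dim_vec (Matrix.vec n (\<lambda>_. 1 :: real))"
    then show "v 0 $ i = Matrix.vec n (\<lambda>_. 1) $ i"
      using mass_pos[of "Suc i"] by (simp add: v_def mass_def)
  qed (simp add: v_def)
  have exp_sums: "(\<lambda>m. x ^ m / fact m) sums exp x" for x :: real
    using exp_converges[of x] by (simp add: divide_inverse mult.commute)
  have "mat_exp ?A *\<^sub>v v 0 \<in> carrier_vec n"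
    by (rule mult_mat_vec_carrier[of _ n n]) (use A in \<open>auto simp: mat_exp_def v_def\<close>)
  then have "scalar_prod (unit_vec n 0) (mat_exp ?A *\<^sub>v v 0) = (mat_exp ?A *\<^sub>v v 0) $ 0"
    using n_pos by simp
  also have "\<dots> = (\<Sum>m. v m $ 0 / fact m)"
    by (rule mat_exp_mult_vec_index[OF A])
       (use n_pos coxian_matrix_step in \<open>auto simp: v_def\<close>)
  also have "\<dots> = (\<Sum>m. \<Sum>k=1..n. q k * ((- \<mu> k * t) ^ m / fact m))"
    using n_pos by (simp add: v_def weight_1 mass_1 sum_divide_distrib)
  also have "\<dots> = (\<Sum>k=1..n. q k * exp (- \<mu> k * t))"
    by (intro sums_unique[symmetric] sums_sum sums_mult exp_sums)
  finally show ?thesis by (simp add: v0)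
qed

lemma coxian_representation_mixture:
  assumes "\<And>t. 0 \<le> t \<Longrightarrow> F t = 1 - (\<Sum>k=1..n. q k * exp (- \<mu> k * t))"
  shows "coxian_representation F n \<mu> continuation"
  unfolding coxian_representation_def
  using n_pos mu_pos continuation_bounds continuation_n assms survival by auto

end

section \<open>Reduction to distinct rates\<close>

lemma finite_real_enumerate_decreasing:
  fixes R :: "real set"
  assumes "finite R"
  obtains x where "bij_betw x {1..card R} R" "strict_antimono_on {1..card R} x"
proof -
  define xs where "xs = sorted_list_of_set R"
  have len: "length xs = card R" and sorted: "sorted_wrt (<) xs"
    by (simp_all add: xs_def)
  \<comment> \<open>The list is ascending and indexed from 0; this reversal makes it descending and
    indexed from 1.\<close>
  have "bij_betw (\<lambda>i. card R - i) {1..card R} {..<card R}"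
    by (rule bij_betwI[where g = "\<lambda>i. card R - i"]) auto
  moreover have "bij_betw ((!) xs) {..<card R} R"
    by (rule bij_betw_nth) (use assms in \<open>simp_all add: xs_def\<close>)
  ultimately have "bij_betw ((!) xs \<circ> (\<lambda>i. card R - i)) {1..card R} R"
    by (rule bij_betw_trans)
  moreover have "strict_antimono_on {1..card R} ((!) xs \<circ> (\<lambda>i. card R - i))"
    using sorted_wrt_nth_less[OF sorted] len by (auto simp: monotone_on_def)
  ultimately show thesis using that by blast
qed

lemma hyperexponential_distinct_rates:
  assumes "hyperexponential_cdf F"
  obtains n q \<mu> where "exponential_mixture n q \<mu>"
    "\<And>t. 0 \<le> t \<Longrightarrow> F t = 1 - (\<Sum>k=1..n. q k * exp (- \<mu> k * t))"
proof -
  obtain n and q \<mu> :: "nat \<Rightarrow> real" where q: "\<And>k. k \<in> {1..n} \<Longrightarrow> 0 \<le> q k" "(\<Sum>k=1..n. q k) = 1"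
    and mu: "\<And>k. k \<in> {1..n} \<Longrightarrow> 0 < \<mu> k"
    and F: "\<And>t. 0 \<le> t \<Longrightarrow> F t = 1 - (\<Sum>k=1..n. q k * exp (- \<mu> k * t))"
    using assms unfolding hyperexponential_cdf_def by blast
  \<comment> \<open>Zero weights are dropped so that every remaining rate receives a positive total
    weight.\<close>
  define K where "K = {k \<in> {1..n}. 0 < q k}"
  define R where "R = \<mu> ` K"
  define w where "w r = sum q {k \<in> K. \<mu> k = r}" for r
  have fin: "finite K" "finite R" by (auto simp: K_def R_def)
  obtain x where x: "bij_betw x {1..card R} R" "strict_antimono_on {1..card R} x"
    using finite_real_enumerate_decreasing[OF fin(2)] .
  \<comment> \<open>A general \<open>f\<close> covers both uses: the constant 1 gives the total
    weight, and the exponential gives the survival function.\<close>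
  have merge: "(\<Sum>i=1..card R. w (x i) * f (x i)) = (\<Sum>k=1..n. q k * f (\<mu> k))"
    for f :: "real \<Rightarrow> real"
  proof -
    have "(\<Sum>i=1..card R. w (x i) * f (x i)) = (\<Sum>r\<in>R. w r * f r)"
      by (rule sum.reindex_bij_betw[OF x(1)])
    also have "\<dots> = (\<Sum>r\<in>R. \<Sum>k\<in>{k \<in> K. \<mu> k = r}. q k * f (\<mu> k))"
      by (simp add: w_def sum_distrib_right)
    also have "\<dots> = (\<Sum>k\<in>K. q k * f (\<mu> k))"
      unfolding R_def by (rule sum.image_gen[OF fin(1), symmetric])
    also have "\<dots> = (\<Sum>k=1..n. q k * f (\<mu> k))"
      using q(1) by (intro sum.mono_neutral_left) (force simp: K_def)+
    finally show ?thesis .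
  qed
  have sum1: "(\<Sum>i=1..card R. w (x i)) = 1" using merge[of "\<lambda>_. 1"] q(2) by simp
  have xR: "x i \<in> R" if "i \<in> {1..card R}" for i
    using x(1) that by (auto simp: bij_betw_def)
  have "0 < w r" if "r \<in> R" for r
    unfolding w_def by (rule sum_pos) (use that fin in \<open>auto simp: R_def K_def\<close>)
  \<comment> \<open>There is at least one rate, since an empty sum could not equal 1.\<close>
  then have "exponential_mixture (card R) (\<lambda>i. w (x i)) x"
    using sum1 x(2) xR mu by unfold_locales (force simp: R_def K_def Suc_le_eq intro: gr0I)+
  then show thesis
    using that[of "card R" "\<lambda>i. w (x i)" x] F merge[of "\<lambda>r. exp (- r * t)" for t] by simp
qed

theorem theorem1: "C_hexp \<subseteq> C_0"
proof
  fix M assume "M \<in> C_hexp"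
  then have M: "M \<in> nonneg_distributions" "hyperexponential_cdf (cdf M)"
    by (auto simp: C_hexp_def)
  obtain n q \<mu> where mix: "exponential_mixture n q \<mu>"
    and F: "\<And>t. 0 \<le> t \<Longrightarrow> cdf M t = 1 - (\<Sum>k=1..n. q k * exp (- \<mu> k * t))"
    using hyperexponential_distinct_rates[OF M(2)] by blast
  interpret exponential_mixture n q \<mu> by (rule mix)
  show "M \<in> C_0"
    using M(1) coxian_representation_mixture[OF F] exit_rate_decreasing unfolding C_0_def by blast
qed

end
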